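(* The collection of abstract quantum cluster structures over simple directed graphs, together with morphisms of abstract quantum cluster structures (composition being $(G,\chi',\alpha')\circ(F,\chi,\alpha)=(G\circ F,\chi'\circ\chi,\alpha'\circ\alpha)$ with $(\chi'\circ\chi)_c=\chi'_{Fc}\circ\chi_c$ and $(\alpha'\circ\alpha)_c=\alpha'_{Fc}\circ\alpha_c$), forms a category.
   Context: Ab is the category of abelian groups; $A^*=\mathrm{Hom}_{\mathbb Z}(A,\mathbb Z)$; for $F\colon\mathcal C\to \mathrm{Ab}$, $F^*\colon\mathcal C^{op}\to\mathrm{Ab}$ is $F^*c=(Fc)^*$, $F^*f=(Ff)^*$. Signed path category. Let $E$ be a simple directed graph (no loops, at most one arrow with given source and target; 2-cycles allowed). $E_\pm$ has the same vertices and, for each arrow $\alpha\colon c\to d$ of $E$, two arrows $\alpha^+,\alpha^-\colon c\to d$. $\mathcal E(E)$ is the quotient of the path category of $E_\pm$ by the relations $\gamma^-\circ\alpha^+=\mathrm{id}_c$ and $\gamma^+\circ\alpha^-=\mathrm{id}_c$ whenever $\alpha\colon c\to d$ and $\gamma\colon d\to c$ are arrows of $E$. Pairing. For $F\colon\mathcal C\to\mathrm{Ab}$ and $G\colon\mathcal C^{op}\to\mathrm{Ab}$, a pairing $\langle-,-\rangle\colon F\otimes_{\mathbb Z}G\to\underline{\mathbb Z}$ is a dinatural transformation, i.e. a family of bilinear forms $\langle-,-\rangle_c\colon Fc\times Gc\to\mathbb Z$ with $\langle a,Gf(b)\rangle_c=\langle Ff(a),b\rangle_d$ for all $f\colon c\to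 d$, $a\in Fc$, $b\in Gd$. It is right non-degenerate if each $\delta_{Gc}\colon Gc\to (Fc)^*$, $b\mapsto\langle-,b\rangle_c$, is injective. A free abelian sheaf is a functor to Ab of the form $\mathrm{Free}_{\mathbb Z}\circ\mathcal B$ with $\mathcal B$ a Set-valued functor on the same domain. Factorization. For $\mathcal P\colon\mathcal E^{op}\to\mathrm{Ab}$ and $\mathcal Q\colon\mathcal E\to\mathrm{Ab}$, a factorization $\mathcal P\to\mathcal Q$ is a family $\theta_c\colon\mathcal Pc\to\mathcal Qc$ with $\theta_d=\mathcal Qf\circ\theta_c\circ\mathcal Pf$ for all $f\colon c\to d$ in $\mathcal E$; a factorization $\mathcal Q\to\mathcal P$ is a family $\theta_c\colon\mathcal Qc\to\mathcal Pc$ with $\theta_c=\mathcal Pf\circ\theta_d\circ\mathcal Qf$. Abstract cluster structure over $E$: a tuple $(\mathcal E,\mathcal X,\beta,\mathcal A,\langle-,-\rangle)$ with $\mathcal E=\mathcal E(E)$, $\mathcal X\colon\mathcal E^{op}\to\mathrm{Ab}$ and $\mathcal A\colon\mathcal E\to\mathrm{Ab}$ free abelian sheaves, $\beta\colon\mathcal X\to\mathcal A$ a factorization, $\langle-,-\rangle\colon\mathcal A\otimes_{\mathbb Z}\mathcal X\to\underline{\mathbb Z}$ a right non-degenerate pairing. Abstract quantum cluster structure: a tuple $(\mathcal E,\mathcal X,\beta,\lambda,\mathcal A,\langle-,-\rangle)$ where $(\mathcal E,\mathcal X,\beta,\mathcal A,\langle-,-\rangle)$ is an abstract cluster structure and $\lambda\colon\mathcal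 A\to\mathcal A^*$ is a factorization of the form $\lambda=\delta_{\mathcal X}\circ\rho$, with $\rho\colon\mathcal A\to\mathcal X$ a factorization such that $\rho_c\circ\beta_c=\mathrm{id}_{\mathcal Xc}$ for all $c$, and $\delta_{\mathcal X}\colon\mathcal X\to\mathcal A^*$ given by $\delta_{\mathcal Xc}(x)=\langle-,x\rangle_c$. A morphism from $(\mathcal E_1,\mathcal X_1,\beta_1,\lambda_1,\mathcal A_1,\langle-,-\rangle^1)$ to $(\mathcal E_2,\mathcal X_2,\beta_2,\lambda_2,\mathcal A_2,\langle-,-\rangle^2)$ is a tuple $(F,\chi,\alpha)$ with $F\colon\mathcal E_1\to\mathcal E_2$ a functor, $\chi\colon\mathcal X_1\to\mathcal X_2F^{op}$ and $\alpha\colon\mathcal A_1\to\mathcal A_2F$ natural transformations, such that for all $c$: $\alpha_c\circ(\beta_1)_c=(\beta_2)_{Fc}\circ\chi_c$ and $(\lambda_1)_c=(\alpha_c)^*\circ(\lambda_2)_{Fc}\circ\alpha_c$. *)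

theory Defs
  imports "HOL-Algebra.Free_Abelian_Groups" "Graph_Theory.Arc_Walk"
begin

section \<open>Categories, functors, natural transformations\<close>

text \<open>All function-valued data is extensional (undefined outside the intended domain), so that
  HOL equality of functors and of natural transformations is the mathematical equality.\<close>

record ('o, 'm) category_data =
  Obj :: "'o set"
  Arr :: "'m set"
  Dom :: "'m \<Rightarrow> 'o"
  Cod :: "'m \<Rightarrow> 'o"
  Id :: "'o \<Rightarrow> 'm"
  Comp :: "'m \<Rightarrow> 'm \<Rightarrow> 'm"  \<comment> \<open>\<open>Comp C g f\<close> is ``g after f''\<close>

definition Hom :: "('o, 'm) category_data \<Rightarrow> 'o \<Rightarrow> 'o \<Rightarrow> 'm set" where
  "Hom C a b = {f \<in> Arr C. Dom C f = a \<and> Cod C f = b}"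

locale category =
  fixes C :: "('o, 'm) category_data"
  assumes dom_obj: "f \<in> Arr C \<Longrightarrow> Dom C f \<in> Obj C"
    and cod_obj: "f \<in> Arr C \<Longrightarrow> Cod C f \<in> Obj C"
    and id_hom: "a \<in> Obj C \<Longrightarrow> Id C a \<in> Hom C a a"
    and comp_hom: "f \<in> Hom C a b \<Longrightarrow> g \<in> Hom C b c \<Longrightarrow> Comp C g f \<in> Hom C a c"
    and comp_id_left: "f \<in> Hom C a b \<Longrightarrow> Comp C (Id C b) f = f"
    and comp_id_right: "f \<in> Hom C a b \<Longrightarrow> Comp C f (Id C a) = f"
    and comp_assoc: "f \<in> Hom C a b \<Longrightarrow> g \<in> Hom C b c \<Longrightarrow> h \<in> Hom C c d \<Longrightarrow>
      Comp C h (Comp C g f) = Comp C (Comp C h g) f"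

definition op_cat :: "('o, 'm) category_data \<Rightarrow> ('o, 'm) category_data" where
  "op_cat C = \<lparr>Obj = Obj C, Arr = Arr C, Dom = Cod C, Cod = Dom C, Id = Id C,
     Comp = (\<lambda>g f. Comp C f g)\<rparr>"

record ('o, 'm, 'p, 'n) functor_data =
  FObj :: "'o \<Rightarrow> 'p"
  FArr :: "'m \<Rightarrow> 'n"

locale cat_functor = C: category C + D: category D
  for C :: "('o, 'm) category_data" and D :: "('p, 'n) category_data" +
  fixes F :: "('o, 'm, 'p, 'n) functor_data"
  assumes fobj: "FObj F \<in> Obj C \<rightarrow>\<^sub>E Obj D"
    and farr: "FArr F \<in> Arr C \<rightarrow>\<^sub>E Arr D"
    and farr_hom: "f \<in> Hom C a b \<Longrightarrow> FArr F f \<in> Hom D (FObj F a) (FObj F b)"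
    and farr_id: "a \<in> Obj C \<Longrightarrow> FArr F (Id C a) = Id D (FObj F a)"
    and farr_comp: "f \<in> Hom C a b \<Longrightarrow> g \<in> Hom C b c \<Longrightarrow>
      FArr F (Comp C g f) = Comp D (FArr F g) (FArr F f)"

text \<open>A functor \<open>F\<close> from \<open>C\<close> to \<open>D\<close> and its opposite, from \<open>op_cat C\<close> to \<open>op_cat D\<close>, have the
  same object map and the same arrow map, hence are the same value of type \<open>functor_data\<close>.\<close>

definition functor_id :: "('o, 'm) category_data \<Rightarrow> ('o, 'm, 'o, 'm) functor_data" where
  "functor_id C = \<lparr>FObj = (\<lambda>a\<in>Obj C. a), FArr = (\<lambda>f\<in>Arr C. f)\<rparr>"

definition functor_comp :: "('o, 'm) category_data \<Rightarrow> ('p, 'n, 'q, 'k) functor_data \<Rightarrow>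
    ('o, 'm, 'p, 'n) functor_data \<Rightarrow> ('o, 'm, 'q, 'k) functor_data" where
  "functor_comp C G F =
     \<lparr>FObj = compose (Obj C) (FObj G) (FObj F), FArr = compose (Arr C) (FArr G) (FArr F)\<rparr>"

locale natural_transformation = F: cat_functor C D F + G: cat_functor C D G
  for C :: "('o, 'm) category_data" and D :: "('p, 'n) category_data"
    and F G :: "('o, 'm, 'p, 'n) functor_data" +
  fixes \<eta> :: "'o \<Rightarrow> 'n"
  assumes ext: "\<eta> \<in> extensional (Obj C)"
    and component: "a \<in> Obj C \<Longrightarrow> \<eta> a \<in> Hom D (FObj F a) (FObj G a)"
    and natural: "f \<in> Hom C a b \<Longrightarrow> Comp D (FArr G f) (\<eta> a) = Comp D (\<eta> b) (FArr F f)"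

section \<open>Sets, abelian groups, duals\<close>

datatype 'a set_arrow = SetArrow (sdom: "'a set") (scod: "'a set") (sfun: "'a \<Rightarrow> 'a")

definition Set_cat :: "('a set, 'a set_arrow) category_data" where
  "Set_cat = \<lparr>Obj = UNIV, Arr = {f. sfun f \<in> sdom f \<rightarrow>\<^sub>E scod f}, Dom = sdom, Cod = scod,
     Id = (\<lambda>S. SetArrow S S (\<lambda>x\<in>S. x)),
     Comp = (\<lambda>g f. SetArrow (sdom f) (scod g) (compose (sdom f) (sfun g) (sfun f)))\<rparr>"

text \<open>Source and target may have different element types, because the components of a factorization
  run between groups of different types. \<open>Ab_cat\<close> uses the homogeneous instances.\<close>

datatype ('a, 'b) ab_arrow =
  AbArrow (adom: "'a monoid") (acod: "'b monoid") (afun: "'a \<Rightarrow> 'b")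

definition ab_hom :: "'a monoid \<Rightarrow> 'b monoid \<Rightarrow> ('a, 'b) ab_arrow set" where
  "ab_hom G H = {AbArrow G H \<phi> | \<phi>. comm_group G \<and> comm_group H \<and>
     \<phi> \<in> hom G H \<and> \<phi> \<in> extensional (carrier G)}"

definition ab_id :: "'a monoid \<Rightarrow> ('a, 'a) ab_arrow" where
  "ab_id G = AbArrow G G (\<lambda>x\<in>carrier G. x)"

definition ab_comp :: "('b, 'c) ab_arrow \<Rightarrow> ('a, 'b) ab_arrow \<Rightarrow> ('a, 'c) ab_arrow"
    (infixr \<open>\<circ>\<^sub>A\<close> 55) where
  "g \<circ>\<^sub>A f = AbArrow (adom f) (acod g) (compose (carrier (adom f)) (afun g) (afun f))"

definition Ab_cat :: "('a monoid, ('a, 'a) ab_arrow) category_data" where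
  "Ab_cat = \<lparr>Obj = {G. comm_group G}, Arr = (\<Union>G H. ab_hom G H), Dom = adom, Cod = acod,
     Id = ab_id, Comp = ab_comp\<rparr>"

definition dual_group :: "'a monoid \<Rightarrow> ('a \<Rightarrow> int) monoid" where
  "dual_group G = \<lparr>carrier = hom G integer_group \<inter> extensional (carrier G),
     monoid.mult = (\<lambda>\<phi> \<psi>. \<lambda>x\<in>carrier G. \<phi> x + \<psi> x), one = (\<lambda>x\<in>carrier G. 0)\<rparr>"

definition dual_arrow :: "('a, 'b) ab_arrow \<Rightarrow> ('b \<Rightarrow> int, 'a \<Rightarrow> int) ab_arrow" where
  "dual_arrow f = AbArrow (dual_group (acod f)) (dual_group (adom f))
     (\<lambda>\<phi>\<in>carrier (dual_group (acod f)). compose (carrier (adom f)) \<phi> (afun f))"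

type_synonym ('o, 'm, 'a) ab_functor = "('o, 'm, 'a monoid, ('a, 'a) ab_arrow) functor_data"

definition dual_functor ::
    "('o, 'm) category_data \<Rightarrow> ('o, 'm, 'a) ab_functor \<Rightarrow> ('o, 'm, 'a \<Rightarrow> int) ab_functor" where
  "dual_functor C F =
     \<lparr>FObj = (\<lambda>c\<in>Obj C. dual_group (FObj F c)), FArr = (\<lambda>f\<in>Arr C. dual_arrow (FArr F f))\<rparr>"

definition Free_functor :: "('a set, 'a set_arrow, 'a \<Rightarrow>\<^sub>0 int) ab_functor" where
  "Free_functor = \<lparr>FObj = free_Abelian_group,
     FArr = (\<lambda>f\<in>Arr Set_cat. AbArrow (free_Abelian_group (sdom f)) (free_Abelian_group (scod f))
        (\<lambda>x\<in>carrier (free_Abelian_group (sdom f)). frag_extend (frag_of \<circ> sfun f) x))\<rparr>"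

definition free_abelian_sheaf ::
    "('o, 'm) category_data \<Rightarrow> ('o, 'm, 'b \<Rightarrow>\<^sub>0 int) ab_functor \<Rightarrow> bool" where
  "free_abelian_sheaf C F \<longleftrightarrow>
     (\<exists>B. cat_functor C (Set_cat :: ('b set, 'b set_arrow) category_data) B \<and>
          F = functor_comp C Free_functor B)"

section \<open>Signed path categories\<close>

locale simple_digraph = loopfree_digraph + nomulti_digraph

datatype sign = Positive | Negative

definition signed_digraph :: "('v, 'e) pre_digraph \<Rightarrow> ('v, 'e \<times> sign) pre_digraph" where
  "signed_digraph E = \<lparr>verts = verts E, arcs = arcs E \<times> UNIV,
     tail = tail E \<circ> fst, head = head E \<circ> fst\<rparr>"

text \<open>A path is a triple of start vertex, list of arcs in order of traversal, end vertex.\<close>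

type_synonym ('v, 'e) path = "'v \<times> 'e list \<times> 'v"

definition path_category :: "('v, 'e) pre_digraph \<Rightarrow> ('v, ('v, 'e) path) category_data" where
  "path_category G = \<lparr>Obj = verts G, Arr = {(u, p, v). pre_digraph.awalk G u p v},
     Dom = (\<lambda>(u, p, v). u), Cod = (\<lambda>(u, p, v). v), Id = (\<lambda>u. (u, [], u)),
     Comp = (\<lambda>(v', q, w) (u, p, v). (u, p @ q, w))\<rparr>"

text \<open>The least congruence of the category \<open>C\<close> that contains the relation \<open>R\<close> on parallel arrows.\<close>

inductive cat_cong :: "('o, 'm) category_data \<Rightarrow> ('m \<times> 'm) set \<Rightarrow> 'm \<Rightarrow> 'm \<Rightarrow> bool"
  for C R where
  base: "(f, g) \<in> R \<Longrightarrow> f \<in> Hom C a b \<Longrightarrow> g \<in> Hom C a b \<Longrightarrow> cat_cong C R f g"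
| refl: "f \<in> Arr C \<Longrightarrow> cat_cong C R f f"
| sym: "cat_cong C R f g \<Longrightarrow> cat_cong C R g f"
| trans: "cat_cong C R f g \<Longrightarrow> cat_cong C R g h \<Longrightarrow> cat_cong C R f h"
| comp: "cat_cong C R f f' \<Longrightarrow> cat_cong C R g g' \<Longrightarrow> Cod C f = Dom C g \<Longrightarrow>
    cat_cong C R (Comp C g f) (Comp C g' f')"

definition cong_class :: "('o, 'm) category_data \<Rightarrow> ('m \<times> 'm) set \<Rightarrow> 'm \<Rightarrow> 'm set" where
  "cong_class C R f = {g. cat_cong C R f g}"

definition quotient_category ::
    "('o, 'm) category_data \<Rightarrow> ('m \<times> 'm) set \<Rightarrow> ('o, 'm set) category_data" where
  "quotient_category C R = (let rep = (\<lambda>X. SOME f. f \<in> X); A = cong_class C R ` Arr C in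
     \<lparr>Obj = Obj C, Arr = A,
      Dom = (\<lambda>X\<in>A. Dom C (rep X)), Cod = (\<lambda>X\<in>A. Cod C (rep X)),
      Id = (\<lambda>c\<in>Obj C. cong_class C R (Id C c)),
      Comp = (\<lambda>Y\<in>A. \<lambda>X\<in>{X \<in> A. Cod C (rep X) = Dom C (rep Y)}.
                cong_class C R (Comp C (rep Y) (rep X)))\<rparr>)"

definition signed_arrow :: "('v, 'e) pre_digraph \<Rightarrow> sign \<Rightarrow> 'e \<Rightarrow> ('v, 'e \<times> sign) path" where
  "signed_arrow E s e = (tail E e, [(e, s)], head E e)"

definition signed_relations ::
    "('v, 'e) pre_digraph \<Rightarrow> (('v, 'e \<times> sign) path \<times> ('v, 'e \<times> sign) path) set" where
  "signed_relations E = (let P = path_category (signed_digraph E) in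
     \<Union>{{(Comp P (signed_arrow E Negative \<gamma>) (signed_arrow E Positive \<alpha>), Id P (tail E \<alpha>)),
        (Comp P (signed_arrow E Positive \<gamma>) (signed_arrow E Negative \<alpha>), Id P (tail E \<alpha>))} | \<alpha> \<gamma>.
       \<alpha> \<in> arcs E \<and> \<gamma> \<in> arcs E \<and> tail E \<gamma> = head E \<alpha> \<and> head E \<gamma> = tail E \<alpha>})"

type_synonym ('v, 'e) sp_arrow = "('v, 'e \<times> sign) path set"

definition signed_path_category ::
    "('v, 'e) pre_digraph \<Rightarrow> ('v, ('v, 'e) sp_arrow) category_data" where
  "signed_path_category E =
     quotient_category (path_category (signed_digraph E)) (signed_relations E)"

section \<open>Pairings and factorizations\<close>

definition pairing :: "('o, 'm) category_data \<Rightarrow> ('o, 'm, 'a) ab_functor \<Rightarrow>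
    ('o, 'm, 'b) ab_functor \<Rightarrow> ('o \<Rightarrow> 'a \<times> 'b \<Rightarrow> int) \<Rightarrow> bool" where
  "pairing C F G p \<longleftrightarrow> cat_functor C Ab_cat F \<and> cat_functor (op_cat C) Ab_cat G \<and>
     p \<in> extensional (Obj C) \<and>
     (\<forall>c\<in>Obj C. p c \<in> extensional (carrier (FObj F c) \<times> carrier (FObj G c)) \<and>
        (\<forall>b\<in>carrier (FObj G c). (\<lambda>a. p c (a, b)) \<in> hom (FObj F c) integer_group) \<and>
        (\<forall>a\<in>carrier (FObj F c). (\<lambda>b. p c (a, b)) \<in> hom (FObj G c) integer_group)) \<and>
     (\<forall>c d. \<forall>f\<in>Hom C c d. \<forall>a\<in>carrier (FObj F c). \<forall>b\<in>carrier (FObj G d).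
        p c (a, afun (FArr G f) b) = p d (afun (FArr F f) a, b))"

definition pairing_delta :: "('o, 'm, 'a) ab_functor \<Rightarrow> ('o, 'm, 'b) ab_functor \<Rightarrow>
    ('o \<Rightarrow> 'a \<times> 'b \<Rightarrow> int) \<Rightarrow> 'o \<Rightarrow> ('b, 'a \<Rightarrow> int) ab_arrow" where
  "pairing_delta F G p c = AbArrow (FObj G c) (dual_group (FObj F c))
     (\<lambda>b\<in>carrier (FObj G c). \<lambda>a\<in>carrier (FObj F c). p c (a, b))"

definition right_nondegenerate :: "('o, 'm) category_data \<Rightarrow> ('o, 'm, 'a) ab_functor \<Rightarrow>
    ('o, 'm, 'b) ab_functor \<Rightarrow> ('o \<Rightarrow> 'a \<times> 'b \<Rightarrow> int) \<Rightarrow> bool" where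
  "right_nondegenerate C F G p \<longleftrightarrow>
     (\<forall>c\<in>Obj C. inj_on (afun (pairing_delta F G p c)) (carrier (FObj G c)))"

text \<open>In both definitions \<open>P\<close> is contravariant and \<open>Q\<close> covariant on \<open>C\<close>.\<close>

definition factorization_PQ :: "('o, 'm) category_data \<Rightarrow> ('o, 'm, 'a) ab_functor \<Rightarrow>
    ('o, 'm, 'b) ab_functor \<Rightarrow> ('o \<Rightarrow> ('a, 'b) ab_arrow) \<Rightarrow> bool" where
  "factorization_PQ C P Q \<theta> \<longleftrightarrow> cat_functor (op_cat C) Ab_cat P \<and> cat_functor C Ab_cat Q \<and>
     \<theta> \<in> extensional (Obj C) \<and> (\<forall>c\<in>Obj C. \<theta> c \<in> ab_hom (FObj P c) (FObj Q c)) \<and>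
     (\<forall>c d. \<forall>f\<in>Hom C c d. \<theta> d = FArr Q f \<circ>\<^sub>A \<theta> c \<circ>\<^sub>A FArr P f)"

definition factorization_QP :: "('o, 'm) category_data \<Rightarrow> ('o, 'm, 'b) ab_functor \<Rightarrow>
    ('o, 'm, 'a) ab_functor \<Rightarrow> ('o \<Rightarrow> ('b, 'a) ab_arrow) \<Rightarrow> bool" where
  "factorization_QP C Q P \<theta> \<longleftrightarrow> cat_functor C Ab_cat Q \<and> cat_functor (op_cat C) Ab_cat P \<and>
     \<theta> \<in> extensional (Obj C) \<and> (\<forall>c\<in>Obj C. \<theta> c \<in> ab_hom (FObj Q c) (FObj P c)) \<and>
     (\<forall>c d. \<forall>f\<in>Hom C c d. \<theta> c = FArr P f \<circ>\<^sub>A \<theta> d \<circ>\<^sub>A FArr Q f)"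

section \<open>Abstract (quantum) cluster structures\<close>

text \<open>\<open>'x\<close> and \<open>'a\<close> are the types in which the basis sets of the free groups live; they stand in
  for a universe of sets, as do the types \<open>'v\<close> and \<open>'e\<close> of vertices and arcs below.\<close>

record ('o, 'm, 'x, 'a) cluster_data =
  ccat :: "('o, 'm) category_data"
  cX :: "('o, 'm, 'x \<Rightarrow>\<^sub>0 int) ab_functor"
  cfact :: "'o \<Rightarrow> ('x \<Rightarrow>\<^sub>0 int, 'a \<Rightarrow>\<^sub>0 int) ab_arrow"
  cA :: "('o, 'm, 'a \<Rightarrow>\<^sub>0 int) ab_functor"
  cpair :: "'o \<Rightarrow> ('a \<Rightarrow>\<^sub>0 int) \<times> ('x \<Rightarrow>\<^sub>0 int) \<Rightarrow> int"

record ('o, 'm, 'x, 'a) quantum_cluster_data = "('o, 'm, 'x, 'a) cluster_data" +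
  clambda :: "'o \<Rightarrow> ('a \<Rightarrow>\<^sub>0 int, ('a \<Rightarrow>\<^sub>0 int) \<Rightarrow> int) ab_arrow"

definition abstract_cluster_structure ::
    "('v, 'e) pre_digraph \<Rightarrow> ('v, ('v, 'e) sp_arrow, 'x, 'a, 'z) cluster_data_scheme \<Rightarrow> bool" where
  "abstract_cluster_structure E S \<longleftrightarrow>
     ccat S = signed_path_category E \<and>
     free_abelian_sheaf (op_cat (ccat S)) (cX S) \<and>
     free_abelian_sheaf (ccat S) (cA S) \<and>
     factorization_PQ (ccat S) (cX S) (cA S) (cfact S) \<and>
     pairing (ccat S) (cA S) (cX S) (cpair S) \<and>
     right_nondegenerate (ccat S) (cA S) (cX S) (cpair S)"

definition abstract_quantum_cluster_structure ::
    "('v, 'e) pre_digraph \<Rightarrow> ('v, ('v, 'e) sp_arrow, 'x, 'a) quantum_cluster_data \<Rightarrow> bool" where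
  "abstract_quantum_cluster_structure E S \<longleftrightarrow>
     abstract_cluster_structure E S \<and>
     factorization_QP (ccat S) (cA S) (dual_functor (ccat S) (cA S)) (clambda S) \<and>
     (\<exists>\<rho>. factorization_QP (ccat S) (cA S) (cX S) \<rho> \<and>
        (\<forall>c\<in>Obj (ccat S). \<rho> c \<circ>\<^sub>A cfact S c = ab_id (FObj (cX S) c)) \<and>
        (\<forall>c\<in>Obj (ccat S). clambda S c = pairing_delta (cA S) (cX S) (cpair S) c \<circ>\<^sub>A \<rho> c))"

section \<open>The category of abstract quantum cluster structures\<close>

type_synonym ('o, 'm, 'x, 'a) quantum_cluster_mor =
  "('o, 'm, 'o, 'm) functor_data \<times> ('o \<Rightarrow> ('x \<Rightarrow>\<^sub>0 int, 'x \<Rightarrow>\<^sub>0 int) ab_arrow) \<times>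
   ('o \<Rightarrow> ('a \<Rightarrow>\<^sub>0 int, 'a \<Rightarrow>\<^sub>0 int) ab_arrow)"

definition quantum_cluster_morphism :: "('o, 'm, 'x, 'a) quantum_cluster_data \<Rightarrow>
    ('o, 'm, 'x, 'a) quantum_cluster_data \<Rightarrow> ('o, 'm, 'x, 'a) quantum_cluster_mor \<Rightarrow> bool" where
  "quantum_cluster_morphism S T = (\<lambda>(F, \<chi>, \<alpha>).
     cat_functor (ccat S) (ccat T) F \<and>
     natural_transformation (op_cat (ccat S)) Ab_cat (cX S) (functor_comp (op_cat (ccat S)) (cX T) F) \<chi> \<and>
     natural_transformation (ccat S) Ab_cat (cA S) (functor_comp (ccat S) (cA T) F) \<alpha> \<and>
     (\<forall>c\<in>Obj (ccat S). \<alpha> c \<circ>\<^sub>A cfact S c = cfact T (FObj F c) \<circ>\<^sub>A \<chi> c) \<and>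
     (\<forall>c\<in>Obj (ccat S). clambda S c = dual_arrow (\<alpha> c) \<circ>\<^sub>A clambda T (FObj F c) \<circ>\<^sub>A \<alpha> c))"

definition mor_id :: "('o, 'm, 'x, 'a) quantum_cluster_data \<Rightarrow>
    ('o, 'm, 'x, 'a) quantum_cluster_mor" where
  "mor_id S = (functor_id (ccat S), (\<lambda>c\<in>Obj (ccat S). ab_id (FObj (cX S) c)),
     (\<lambda>c\<in>Obj (ccat S). ab_id (FObj (cA S) c)))"

definition mor_comp :: "('o, 'm, 'x, 'a) quantum_cluster_data \<Rightarrow>
    ('o, 'm, 'x, 'a) quantum_cluster_mor \<Rightarrow> ('o, 'm, 'x, 'a) quantum_cluster_mor \<Rightarrow>
    ('o, 'm, 'x, 'a) quantum_cluster_mor" where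
  "mor_comp S = (\<lambda>(G, \<chi>', \<alpha>') (F, \<chi>, \<alpha>). (functor_comp (ccat S) G F,
     (\<lambda>c\<in>Obj (ccat S). \<chi>' (FObj F c) \<circ>\<^sub>A \<chi> c), (\<lambda>c\<in>Obj (ccat S). \<alpha>' (FObj F c) \<circ>\<^sub>A \<alpha> c)))"

text \<open>An arrow is a morphism together with its source and target.\<close>

definition quantum_cluster_category ::
    "(('v, ('v, 'e) sp_arrow, 'x, 'a) quantum_cluster_data,
      ('v, ('v, 'e) sp_arrow, 'x, 'a) quantum_cluster_data \<times>
      ('v, ('v, 'e) sp_arrow, 'x, 'a) quantum_cluster_data \<times>
      ('v, ('v, 'e) sp_arrow, 'x, 'a) quantum_cluster_mor) category_data" where
  "quantum_cluster_category =
     (let Ob = {S. \<exists>E. simple_digraph E \<and> abstract_quantum_cluster_structure E S} in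
     \<lparr>Obj = Ob, Arr = {(S, T, m). S \<in> Ob \<and> T \<in> Ob \<and> quantum_cluster_morphism S T m},
      Dom = (\<lambda>(S, T, m). S), Cod = (\<lambda>(S, T, m). T), Id = (\<lambda>S. (S, S, mor_id S)),
      Comp = (\<lambda>(T', U, m') (S, T, m). (S, U, mor_comp S m' m))\<rparr>)"

end

theory Submission
  imports Defs
begin

text \<open>Componentwise composition of morphisms is the pasting of natural transformations along
  functors, so everything reduces to the category laws in \<open>Ab_cat\<close>. The compatibility with \<open>\<lambda>\<close>
  survives composition because the dual of arrows is contravariantly functorial:
  \<open>\<alpha>\<^sub>c\<^sup>* \<circ> (\<alpha>'\<^sub>F\<^sub>c\<^sup>* \<circ> \<lambda>\<^sub>3 \<circ> \<alpha>'\<^sub>F\<^sub>c) \<circ> \<alpha>\<^sub>c = (\<alpha>'\<^sub>F\<^sub>c \<circ> \<alpha>\<^sub>c)\<^sup>* \<circ> \<lambda>\<^sub>3 \<circ> (\<alpha>'\<^sub>F\<^sub>c \<circ> \<alpha>\<^sub>c)\<close>.\<close>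

section \<open>Functors and natural transformations\<close>

lemma Obj_op_cat [simp]: "Obj (op_cat C) = Obj C"
  and Arr_op_cat [simp]: "Arr (op_cat C) = Arr C"
  and Dom_op_cat [simp]: "Dom (op_cat C) = Cod C"
  and Cod_op_cat [simp]: "Cod (op_cat C) = Dom C"
  and Id_op_cat [simp]: "Id (op_cat C) = Id C"
  and Comp_op_cat [simp]: "Comp (op_cat C) g f = Comp C f g"
  and Hom_op_cat [simp]: "Hom (op_cat C) a b = Hom C b a"
  by (auto simp: op_cat_def Hom_def)

text \<open>Composition only looks at the sets of objects and arrows, which \<open>op_cat\<close>
  keeps. As a simp rule this brings contravariant composites into the form used for covariant
  ones.\<close>

lemma functor_comp_op_cat [simp]: "functor_comp (op_cat C) G F = functor_comp C G F"
  by (simp add: functor_comp_def)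

lemma functor_id_op_cat [simp]: "functor_id (op_cat C) = functor_id C"
  by (simp add: functor_id_def)

lemma (in category) Hom_objD:
  assumes "f \<in> Hom C a b" shows "f \<in> Arr C" "a \<in> Obj C" "b \<in> Obj C"
  using assms dom_obj cod_obj by (auto simp: Hom_def)

lemma category_op_cat:
  assumes "category C" shows "category (op_cat C)"
proof -
  interpret category C by fact
  show ?thesis
    by unfold_locales
      (auto simp: dom_obj cod_obj id_hom comp_id_left comp_id_right comp_assoc intro: comp_hom)
qed

text \<open>Supplies the functor between opposite categories along which the contravariant
  components \<chi> are pasted.\<close>

lemma cat_functor_op_cat:
  assumes "cat_functor C D F" shows "cat_functor (op_cat C) (op_cat D) F"
proof -
  interpret cat_functor C D F by fact
  show ?thesis
    by (intro cat_functor.intro cat_functor_axioms.intro category_op_cat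
        C.category_axioms D.category_axioms)
      (simp_all add: fobj farr farr_hom farr_id farr_comp)
qed

section \<open>Identity functors and composites of functors\<close>

lemma FObj_functor_comp: "a \<in> Obj C \<Longrightarrow> FObj (functor_comp C G F) a = FObj G (FObj F a)"
  and FArr_functor_comp: "f \<in> Arr C \<Longrightarrow> FArr (functor_comp C G F) f = FArr G (FArr F f)"
  by (simp_all add: functor_comp_def compose_def)

lemma FObj_functor_id: "a \<in> Obj C \<Longrightarrow> FObj (functor_id C) a = a"
  by (simp add: functor_id_def)

lemma cat_functor_id:
  assumes "category C" shows "cat_functor C C (functor_id C)"
proof -
  interpret category C by fact
  show ?thesis
    \<comment> \<open>The identity functor is a restricted map, so identities and composites must be
      recognized as members of \<open>Arr C\<close> before it evaluates on them.\<close>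
    by unfold_locales
      (auto simp: functor_id_def dest: Hom_objD Hom_objD [OF id_hom] Hom_objD [OF comp_hom])
qed

lemma cat_functor_comp:
  assumes "cat_functor C D F" "cat_functor D K G"
  shows "cat_functor C K (functor_comp C G F)"
proof -
  interpret F: cat_functor C D F by fact
  interpret G: cat_functor D K G by fact
  show ?thesis
  proof
    show "FObj (functor_comp C G F) \<in> Obj C \<rightarrow>\<^sub>E Obj K"
      using F.fobj G.fobj by (auto simp: functor_comp_def compose_def)
    show "FArr (functor_comp C G F) \<in> Arr C \<rightarrow>\<^sub>E Arr K"
      using F.farr G.farr by (auto simp: functor_comp_def compose_def)
    show "FArr (functor_comp C G F) f
        \<in> Hom K (FObj (functor_comp C G F) a) (FObj (functor_comp C G F) b)"
      if "f \<in> Hom C a b" for f a b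
      using that F.C.Hom_objD [OF that] F.farr_hom G.farr_hom
      by (simp add: FObj_functor_comp FArr_functor_comp)
    show "FArr (functor_comp C G F) (Id C a) = Id K (FObj (functor_comp C G F) a)"
      if "a \<in> Obj C" for a
      using that F.C.Hom_objD [OF F.C.id_hom [OF that]] F.farr_id G.farr_id F.fobj
      by (auto simp: FObj_functor_comp FArr_functor_comp)
    show "FArr (functor_comp C G F) (Comp C g f)
        = Comp K (FArr (functor_comp C G F) g) (FArr (functor_comp C G F) f)"
      if "f \<in> Hom C a b" "g \<in> Hom C b c" for f g a b c
      using F.C.Hom_objD [OF that(1)] F.C.Hom_objD [OF that(2)]
        F.C.Hom_objD [OF F.C.comp_hom [OF that]] F.farr_comp [OF that]
        G.farr_comp [OF F.farr_hom [OF that(1)] F.farr_hom [OF that(2)]]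
      by (simp add: FArr_functor_comp)
  qed
qed

text \<open>Restricted composites reassociate because \<open>F\<close> maps into the objects and
  arrows of \<open>D\<close>, the sets to which the composite of \<open>H\<close> and
  \<open>G\<close> is restricted.\<close>

lemma functor_comp_assoc:
  assumes "cat_functor C D F"
  shows "functor_comp C H (functor_comp C G F) = functor_comp C (functor_comp D H G) F"
proof -
  interpret cat_functor C D F by fact
  show ?thesis
    using fobj farr by (auto simp: functor_comp_def PiE_def intro!: compose_assoc)
qed

lemma functor_comp_id_right:
  assumes "cat_functor C D F" shows "functor_comp C F (functor_id C) = F"
proof -
  interpret cat_functor C D F by fact
  have "compose (Obj C) (FObj F) (\<lambda>a\<in>Obj C. a) = FObj F"
    and "compose (Arr C) (FArr F) (\<lambda>a\<in>Arr C. a) = FArr F"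
    using fobj farr by (auto simp: PiE_def intro: compose_Id)
  then show ?thesis
    by (simp add: functor_comp_def functor_id_def)
qed

lemma functor_comp_id_left:
  assumes "cat_functor C D F" shows "functor_comp C (functor_id D) F = F"
proof -
  interpret cat_functor C D F by fact
  have "compose (Obj C) (\<lambda>a\<in>Obj D. a) (FObj F) = FObj F"
    and "compose (Arr C) (\<lambda>a\<in>Arr D. a) (FArr F) = FArr F"
    using fobj farr by (auto simp: PiE_def intro: Id_compose)
  then show ?thesis
    by (simp add: functor_comp_def functor_id_def)
qed

section \<open>Natural transformations: identities and pasting\<close>

lemma natural_transformation_id:
  assumes "cat_functor C K X"
  shows "natural_transformation C K X X (\<lambda>a\<in>Obj C. Id K (FObj X a))"
proof -
  interpret cat_functor C K X by fact
  have *: "a \<in> Obj C \<Longrightarrow> FObj X a \<in> Obj K" for a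
    using fobj by auto
  show ?thesis
    by unfold_locales
      (use * in \<open>auto simp: D.id_hom C.Hom_objD D.comp_id_left [OF farr_hom]
          D.comp_id_right [OF farr_hom]\<close>)
qed

text \<open>The result is the vertical composite of \<eta> with \<theta> whiskered by
  \<open>F\<close>. The three categories are arbitrary, so the same lemma composes the \<alpha> part
  and, over opposite categories, the \<chi> part.\<close>

lemma natural_transformation_paste:
  assumes "cat_functor C D F"
    and "natural_transformation C K X (functor_comp C Y F) \<eta>"
    and "natural_transformation D K Y W \<theta>"
  shows "natural_transformation C K X (functor_comp C W F)
    (\<lambda>c\<in>Obj C. Comp K (\<theta> (FObj F c)) (\<eta> c))"
proof -
  interpret F: cat_functor C D F by fact
  interpret \<eta>: natural_transformation C K X "functor_comp C Y F" \<eta> by fact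
  interpret \<theta>: natural_transformation D K Y W \<theta> by fact
  have obj: "a \<in> Obj C \<Longrightarrow> FObj F a \<in> Obj D" for a
    using F.fobj by auto
  have eta: "\<eta> a \<in> Hom K (FObj X a) (FObj Y (FObj F a))" if "a \<in> Obj C" for a
    using \<eta>.component [OF that] that by (simp add: FObj_functor_comp)
  note theta = \<theta>.component [OF obj]
  show ?thesis
  proof (intro natural_transformation.intro natural_transformation_axioms.intro)
    show "cat_functor C K X" by unfold_locales
    show "cat_functor C K (functor_comp C W F)"
      using \<theta>.G.cat_functor_axioms cat_functor_comp assms(1) by blast
    show "(\<lambda>c\<in>Obj C. Comp K (\<theta> (FObj F c)) (\<eta> c)) \<in> extensional (Obj C)" by simp
    show "(\<lambda>c\<in>Obj C. Comp K (\<theta> (FObj F c)) (\<eta> c)) a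
        \<in> Hom K (FObj X a) (FObj (functor_comp C W F) a)" if "a \<in> Obj C" for a
      using \<eta>.F.D.comp_hom [OF eta theta] that by (simp add: FObj_functor_comp)
    show "Comp K (FArr (functor_comp C W F) f) ((\<lambda>c\<in>Obj C. Comp K (\<theta> (FObj F c)) (\<eta> c)) a)
        = Comp K ((\<lambda>c\<in>Obj C. Comp K (\<theta> (FObj F c)) (\<eta> c)) b) (FArr X f)"
      if f: "f \<in> Hom C a b" for f a b
    proof -
      note fab = F.C.Hom_objD [OF f] and Ff = F.farr_hom [OF f]
      have "Comp K (FArr W (FArr F f)) (Comp K (\<theta> (FObj F a)) (\<eta> a))
          = Comp K (Comp K (FArr W (FArr F f)) (\<theta> (FObj F a))) (\<eta> a)"
        using \<eta>.F.D.comp_assoc eta theta \<theta>.G.farr_hom Ff fab by blast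
      \<comment> \<open>The square of \<theta> is taken at the image arrow \<open>FArr F f\<close>;
        the square of \<eta> at \<open>f\<close> itself follows after reassociating.\<close>
      also have "\<dots> = Comp K (Comp K (\<theta> (FObj F b)) (FArr Y (FArr F f))) (\<eta> a)"
        by (simp add: \<theta>.natural [OF Ff])
      also have "\<dots> = Comp K (\<theta> (FObj F b)) (Comp K (FArr Y (FArr F f)) (\<eta> a))"
        using \<eta>.F.D.comp_assoc eta theta \<theta>.F.farr_hom Ff fab by metis
      also have "\<dots> = Comp K (\<theta> (FObj F b)) (Comp K (\<eta> b) (FArr X f))"
        using \<eta>.natural [OF f] fab by (simp add: FArr_functor_comp)
      also have "\<dots> = Comp K (Comp K (\<theta> (FObj F b)) (\<eta> b)) (FArr X f)"
        using \<eta>.F.D.comp_assoc eta theta \<eta>.F.farr_hom f fab by blast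
      finally show ?thesis
        using fab by (simp add: FArr_functor_comp)
    qed
  qed
qed

section \<open>Arrows of abelian groups\<close>

lemma Hom_Ab_cat [simp]: "Hom Ab_cat G H = ab_hom G H"
  by (auto simp: Hom_def Ab_cat_def ab_hom_def)

lemma Comp_Ab_cat [simp]: "Comp Ab_cat = ab_comp"
  and Id_Ab_cat [simp]: "Id Ab_cat = ab_id"
  by (simp_all add: Ab_cat_def)

lemma adom_ab_hom: "f \<in> ab_hom G H \<Longrightarrow> adom f = G"
  and acod_ab_hom: "f \<in> ab_hom G H \<Longrightarrow> acod f = H"
  and afun_ab_hom: "f \<in> ab_hom G H \<Longrightarrow> afun f \<in> hom G H"
  by (auto simp: ab_hom_def)

lemma afun_ab_hom_funcset: "f \<in> ab_hom G H \<Longrightarrow> afun f \<in> carrier G \<rightarrow> carrier H"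
  by (auto dest!: afun_ab_hom simp: hom_def)

text \<open>The laws of \<open>Ab_cat\<close> cover a single element type, while \<beta>, \<lambda>
  and dual arrows change the type; hence a direct proof for \<open>ab_comp\<close>. Assuming only
  where the underlying map lands avoids showing first that composites lie in
  \<open>ab_hom\<close>.\<close>

lemma ab_comp_assoc:
  assumes "afun f \<in> carrier (adom f) \<rightarrow> carrier (adom g)"
  shows "(h \<circ>\<^sub>A g) \<circ>\<^sub>A f = h \<circ>\<^sub>A g \<circ>\<^sub>A f"
  by (simp add: ab_comp_def compose_assoc [OF assms, symmetric])

lemma ab_comp_assoc_hom:
  assumes "f \<in> ab_hom G H" "adom g = H"
  shows "(h \<circ>\<^sub>A g) \<circ>\<^sub>A f = h \<circ>\<^sub>A g \<circ>\<^sub>A f"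
  using assms adom_ab_hom [OF assms(1)] afun_ab_hom_funcset by (intro ab_comp_assoc) auto

lemma ab_comp_id_left:
  assumes "f \<in> ab_hom G H" shows "ab_id H \<circ>\<^sub>A f = f"
  using assms Id_compose [of "afun f" "carrier G" "carrier H"] afun_ab_hom_funcset [OF assms]
  by (auto simp: ab_id_def ab_comp_def ab_hom_def)

lemma ab_comp_id_right:
  assumes "f \<in> ab_hom G H" shows "f \<circ>\<^sub>A ab_id G = f"
  using assms compose_Id [of "afun f" "carrier G" "carrier H"] afun_ab_hom_funcset [OF assms]
  by (auto simp: ab_id_def ab_comp_def ab_hom_def)

lemma adom_ab_comp [simp]: "adom (g \<circ>\<^sub>A f) = adom f"
  by (simp add: ab_comp_def)

section \<open>Duals of arrows\<close>

lemma adom_dual_arrow [simp]: "adom (dual_arrow f) = dual_group (acod f)"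
  by (simp add: dual_arrow_def)

text \<open>Pulling back along a homomorphism preserves integer-valued homomorphisms. Closure of
  \<open>G\<close> under multiplication enters because the restricted composite must be evaluated at
  products.\<close>

lemma dual_arrow_funcset:
  assumes "f \<in> ab_hom G H"
  shows "afun (dual_arrow f) \<in> carrier (dual_group H) \<rightarrow> carrier (dual_group G)"
  using assms
  by (auto simp: dual_arrow_def dual_group_def ab_hom_def compose_def hom_def Pi_iff
      comm_group_def dest: monoid.m_closed [OF group.is_monoid])

lemma dual_arrow_ab_id: "dual_arrow (ab_id G) = ab_id (dual_group G)"
  by (auto simp: dual_arrow_def ab_id_def dual_group_def compose_def restrict_def extensional_def
      fun_eq_iff)

text \<open>Both sides precompose a functional on \<open>K\<close> with \<open>g\<close> and then
  with \<open>f\<close>, so associativity of restricted composition identifies them.\<close>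

lemma dual_arrow_ab_comp:
  assumes f: "f \<in> ab_hom G H" and g: "g \<in> ab_hom H K"
  shows "dual_arrow (g \<circ>\<^sub>A f) = dual_arrow f \<circ>\<^sub>A dual_arrow g"
proof -
  have "compose (carrier G) \<phi> (compose (carrier G) (afun g) (afun f))
      = compose (carrier G) (compose (carrier H) \<phi> (afun g)) (afun f)" for \<phi> :: "_ \<Rightarrow> int"
    using afun_ab_hom_funcset [OF f] by (rule compose_assoc)
  \<comment> \<open>\<open>dual_arrow f\<close> is specified only on the dual of \<open>H\<close>,
    so the intermediate functional has to be placed there before it can be evaluated.\<close>
  moreover have "compose (carrier H) \<phi> (afun g) \<in> carrier (dual_group H)"
    if "\<phi> \<in> carrier (dual_group K)" for \<phi> :: "_ \<Rightarrow> int"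
    using funcset_mem [OF dual_arrow_funcset [OF g] that] that g
    by (simp add: dual_arrow_def adom_ab_hom acod_ab_hom)
  ultimately show ?thesis
    using f g
    by (auto simp: dual_arrow_def ab_comp_def adom_ab_hom acod_ab_hom fun_eq_iff
        compose_def [of "carrier (dual_group K)"])
qed

section \<open>Morphisms of abstract quantum cluster structures\<close>

lemma abstract_quantum_cluster_structureD:
  assumes "abstract_quantum_cluster_structure E S"
  shows "cat_functor (op_cat (ccat S)) Ab_cat (cX S)"
    and "cat_functor (ccat S) Ab_cat (cA S)"
    and "category (ccat S)"
    and "c \<in> Obj (ccat S) \<Longrightarrow> cfact S c \<in> ab_hom (FObj (cX S) c) (FObj (cA S) c)"
    and "c \<in> Obj (ccat S) \<Longrightarrow> clambda S c \<in> ab_hom (FObj (cA S) c) (dual_group (FObj (cA S) c))"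
  using assms
  by (auto simp: abstract_quantum_cluster_structure_def abstract_cluster_structure_def
      factorization_PQ_def factorization_QP_def dual_functor_def cat_functor_def)

text \<open>Besides unpacking the conditions, this evaluates the composite functors on objects,
  giving the types of the components, and records the extensionality on which the unit laws
  rest.\<close>

lemma quantum_cluster_morphismD:
  assumes "quantum_cluster_morphism S T (F, \<chi>, \<alpha>)"
  shows "cat_functor (ccat S) (ccat T) F"
    and "natural_transformation (op_cat (ccat S)) Ab_cat (cX S)
      (functor_comp (ccat S) (cX T) F) \<chi>"
    and "natural_transformation (ccat S) Ab_cat (cA S) (functor_comp (ccat S) (cA T) F) \<alpha>"
    and "\<chi> \<in> extensional (Obj (ccat S))"
    and "\<alpha> \<in> extensional (Obj (ccat S))"
    and "c \<in> Obj (ccat S) \<Longrightarrow> FObj F c \<in> Obj (ccat T)"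
    and "c \<in> Obj (ccat S) \<Longrightarrow> \<chi> c \<in> ab_hom (FObj (cX S) c) (FObj (cX T) (FObj F c))"
    and "c \<in> Obj (ccat S) \<Longrightarrow> \<alpha> c \<in> ab_hom (FObj (cA S) c) (FObj (cA T) (FObj F c))"
    and "c \<in> Obj (ccat S) \<Longrightarrow> \<alpha> c \<circ>\<^sub>A cfact S c = cfact T (FObj F c) \<circ>\<^sub>A \<chi> c"
    and "c \<in> Obj (ccat S) \<Longrightarrow>
      clambda S c = dual_arrow (\<alpha> c) \<circ>\<^sub>A clambda T (FObj F c) \<circ>\<^sub>A \<alpha> c"
proof -
  show F: "cat_functor (ccat S) (ccat T) F"
    and X: "natural_transformation (op_cat (ccat S)) Ab_cat (cX S)
      (functor_comp (ccat S) (cX T) F) \<chi>"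
    and A: "natural_transformation (ccat S) Ab_cat (cA S) (functor_comp (ccat S) (cA T) F) \<alpha>"
    and "c \<in> Obj (ccat S) \<Longrightarrow> \<alpha> c \<circ>\<^sub>A cfact S c = cfact T (FObj F c) \<circ>\<^sub>A \<chi> c"
    and "c \<in> Obj (ccat S) \<Longrightarrow>
      clambda S c = dual_arrow (\<alpha> c) \<circ>\<^sub>A clambda T (FObj F c) \<circ>\<^sub>A \<alpha> c"
    using assms by (auto simp: quantum_cluster_morphism_def)
  show "\<chi> \<in> extensional (Obj (ccat S))" "\<alpha> \<in> extensional (Obj (ccat S))"
    using natural_transformation.ext [OF X] natural_transformation.ext [OF A] by simp_all
  show "FObj F c \<in> Obj (ccat T)" if "c \<in> Obj (ccat S)"
    using cat_functor.fobj [OF F] that by auto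
  show "\<chi> c \<in> ab_hom (FObj (cX S) c) (FObj (cX T) (FObj F c))"
    "\<alpha> c \<in> ab_hom (FObj (cA S) c) (FObj (cA T) (FObj F c))" if "c \<in> Obj (ccat S)"
    using natural_transformation.component [OF X, of c]
      natural_transformation.component [OF A, of c] that
    by (simp_all add: FObj_functor_comp)
qed

section \<open>Identities and composites are morphisms\<close>

lemma quantum_cluster_morphism_mor_id:
  assumes "abstract_quantum_cluster_structure E S"
  shows "quantum_cluster_morphism S S (mor_id S)"
proof -
  note S = abstract_quantum_cluster_structureD [OF assms]
  have "natural_transformation (op_cat (ccat S)) Ab_cat (cX S)
      (functor_comp (ccat S) (cX S) (functor_id (ccat S)))
      (\<lambda>c\<in>Obj (ccat S). ab_id (FObj (cX S) c))"
    using natural_transformation_id [OF S(1)] functor_comp_id_right [OF S(1)] by simp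
  moreover have "natural_transformation (ccat S) Ab_cat (cA S)
      (functor_comp (ccat S) (cA S) (functor_id (ccat S)))
      (\<lambda>c\<in>Obj (ccat S). ab_id (FObj (cA S) c))"
    using natural_transformation_id [OF S(2)] functor_comp_id_right [OF S(2)] by simp
  ultimately show ?thesis
    using cat_functor_id [OF S(3)]
    by (simp add: quantum_cluster_morphism_def mor_id_def FObj_functor_id dual_arrow_ab_id
        ab_comp_id_left [OF S(4)] ab_comp_id_right [OF S(4)]
        ab_comp_id_left [OF S(5)] ab_comp_id_right [OF S(5)])
qed

text \<open>Three separate graphs appear because each object of the category brings its own graph as
  an existential witness.\<close>

lemma quantum_cluster_morphism_mor_comp:
  assumes S: "abstract_quantum_cluster_structure E S"
    and T: "abstract_quantum_cluster_structure E' T"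
    and U: "abstract_quantum_cluster_structure E'' U"
    and m: "quantum_cluster_morphism S T m" and m': "quantum_cluster_morphism T U m'"
  shows "quantum_cluster_morphism S U (mor_comp S m' m)"
proof -
  obtain F \<chi> \<alpha> where m_eq: "m = (F, \<chi>, \<alpha>)" by (cases m)
  obtain G \<chi>' \<alpha>' where m'_eq: "m' = (G, \<chi>', \<alpha>')" by (cases m')
  note mD = quantum_cluster_morphismD [OF m [unfolded m_eq]]
  note m'D = quantum_cluster_morphismD [OF m' [unfolded m'_eq]]
  note SD = abstract_quantum_cluster_structureD [OF S]
  note TD = abstract_quantum_cluster_structureD [OF T]
  note UD = abstract_quantum_cluster_structureD [OF U]
  have X: "natural_transformation (op_cat (ccat S)) Ab_cat (cX S)
      (functor_comp (ccat S) (cX U) (functor_comp (ccat S) G F))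
      (\<lambda>c\<in>Obj (ccat S). \<chi>' (FObj F c) \<circ>\<^sub>A \<chi> c)"
    \<comment> \<open>The open premise concerns a composite over \<open>op_cat (ccat S)\<close>; it
      matches \<open>mD(2)\<close> only after \<open>functor_comp_op_cat\<close> rewrites
      it.\<close>
    using natural_transformation_paste [OF cat_functor_op_cat [OF mD(1)] _ m'D(2), of "cX S" \<chi>]
      mD(2)
    by (simp add: functor_comp_assoc [OF mD(1)])
  have A: "natural_transformation (ccat S) Ab_cat (cA S)
      (functor_comp (ccat S) (cA U) (functor_comp (ccat S) G F))
      (\<lambda>c\<in>Obj (ccat S). \<alpha>' (FObj F c) \<circ>\<^sub>A \<alpha> c)"
    using natural_transformation_paste [OF mD(1) mD(3) m'D(3)]
    by (simp add: functor_comp_assoc [OF mD(1)])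
  have beta: "(\<alpha>' (FObj F c) \<circ>\<^sub>A \<alpha> c) \<circ>\<^sub>A cfact S c
      = cfact U (FObj G (FObj F c)) \<circ>\<^sub>A \<chi>' (FObj F c) \<circ>\<^sub>A \<chi> c"
    if c: "c \<in> Obj (ccat S)" for c
  proof -
    \<comment> \<open>The first \<beta> is moved past \<alpha> by the square of \<open>m\<close> at
      \<open>c\<close>, then the second past \<alpha>' by the square of \<open>m'\<close> at
      \<open>FObj F c\<close>.\<close>
    note d = mD(6) [OF c]
    have "(\<alpha>' (FObj F c) \<circ>\<^sub>A \<alpha> c) \<circ>\<^sub>A cfact S c = \<alpha>' (FObj F c) \<circ>\<^sub>A \<alpha> c \<circ>\<^sub>A cfact S c"
      by (rule ab_comp_assoc_hom [OF SD(4) [OF c] adom_ab_hom [OF mD(8) [OF c]]])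
    also have "\<dots> = (\<alpha>' (FObj F c) \<circ>\<^sub>A cfact T (FObj F c)) \<circ>\<^sub>A \<chi> c"
      unfolding mD(9) [OF c]
      by (rule ab_comp_assoc_hom [OF mD(7) [OF c] adom_ab_hom [OF TD(4) [OF d]], symmetric])
    also have "\<dots> = cfact U (FObj G (FObj F c)) \<circ>\<^sub>A \<chi>' (FObj F c) \<circ>\<^sub>A \<chi> c"
      unfolding m'D(9) [OF d]
      by (rule ab_comp_assoc_hom [OF mD(7) [OF c] adom_ab_hom [OF m'D(7) [OF d]]])
    finally show ?thesis .
  qed
  have lambda: "clambda S c = dual_arrow (\<alpha>' (FObj F c) \<circ>\<^sub>A \<alpha> c)
      \<circ>\<^sub>A clambda U (FObj G (FObj F c)) \<circ>\<^sub>A \<alpha>' (FObj F c) \<circ>\<^sub>A \<alpha> c"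
    if c: "c \<in> Obj (ccat S)" for c
  proof -
    note d = mD(6) [OF c]
    note e = m'D(6) [OF d]
    let ?a = "\<alpha> c" and ?b = "\<alpha>' (FObj F c)" and ?L = "clambda U (FObj G (FObj F c))"
    note a = mD(8) [OF c] and b = m'D(8) [OF d] and L = UD(5) [OF e]
    \<comment> \<open>This composite takes values in the dual on which \<open>dual_arrow ?b\<close>
      is defined; that is the side condition for bracketing the two dual arrows together
      below.\<close>
    have La: "afun (?L \<circ>\<^sub>A ?b \<circ>\<^sub>A ?a) \<in> carrier (adom (?L \<circ>\<^sub>A ?b \<circ>\<^sub>A ?a))
        \<rightarrow> carrier (adom (dual_arrow ?b))"
      using afun_ab_hom_funcset [OF a] afun_ab_hom_funcset [OF b] afun_ab_hom_funcset [OF L]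
      by (simp add: Pi_iff ab_comp_def compose_def adom_ab_hom [OF a] acod_ab_hom [OF b])
    have "clambda S c = dual_arrow ?a \<circ>\<^sub>A (dual_arrow ?b \<circ>\<^sub>A ?L \<circ>\<^sub>A ?b) \<circ>\<^sub>A ?a"
      using mD(10) [OF c] m'D(10) [OF d] by simp
    also have "(dual_arrow ?b \<circ>\<^sub>A ?L \<circ>\<^sub>A ?b) \<circ>\<^sub>A ?a = dual_arrow ?b \<circ>\<^sub>A (?L \<circ>\<^sub>A ?b) \<circ>\<^sub>A ?a"
      by (rule ab_comp_assoc_hom [OF a]) (simp add: adom_ab_hom [OF b])
    also have "(?L \<circ>\<^sub>A ?b) \<circ>\<^sub>A ?a = ?L \<circ>\<^sub>A ?b \<circ>\<^sub>A ?a"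
      by (rule ab_comp_assoc_hom [OF a adom_ab_hom [OF b]])
    also have "dual_arrow ?a \<circ>\<^sub>A dual_arrow ?b \<circ>\<^sub>A ?L \<circ>\<^sub>A ?b \<circ>\<^sub>A ?a
        = (dual_arrow ?a \<circ>\<^sub>A dual_arrow ?b) \<circ>\<^sub>A ?L \<circ>\<^sub>A ?b \<circ>\<^sub>A ?a"
      by (rule ab_comp_assoc [OF La, symmetric])
    finally show ?thesis
      by (simp add: dual_arrow_ab_comp [OF a b])
  qed
  show ?thesis
    using X A beta lambda cat_functor_comp [OF mD(1) m'D(1)]
    by (simp add: quantum_cluster_morphism_def mor_comp_def m_eq m'_eq FObj_functor_comp)
qed

section \<open>Unit and associativity laws for morphisms\<close>

lemma mor_comp_id_left:
  assumes "quantum_cluster_morphism S T m" shows "mor_comp S (mor_id T) m = m"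
proof -
  obtain F \<chi> \<alpha> where m: "m = (F, \<chi>, \<alpha>)" by (cases m)
  note mD = quantum_cluster_morphismD [OF assms [unfolded m]]
  \<comment> \<open>On objects the identity component cancels; elsewhere both sides are
    \<open>undefined\<close>, since \<chi> and \<alpha> are extensional.\<close>
  show ?thesis
    using mD(4,5)
    by (auto simp: m mor_comp_def mor_id_def functor_comp_id_left [OF mD(1)] mD(6)
        ab_comp_id_left [OF mD(7)] ab_comp_id_left [OF mD(8)]
        intro!: extensionalityI [of _ "Obj (ccat S)"])
qed

lemma mor_comp_id_right:
  assumes "quantum_cluster_morphism S T m" shows "mor_comp S m (mor_id S) = m"
proof -
  obtain F \<chi> \<alpha> where m: "m = (F, \<chi>, \<alpha>)" by (cases m)
  note mD = quantum_cluster_morphismD [OF assms [unfolded m]]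
  show ?thesis
    using mD(4,5)
    by (auto simp: m mor_comp_def mor_id_def functor_comp_id_right [OF mD(1)] FObj_functor_id
        ab_comp_id_right [OF mD(7)] ab_comp_id_right [OF mD(8)]
        intro!: extensionalityI [of _ "Obj (ccat S)"])
qed

lemma mor_comp_assoc:
  assumes "quantum_cluster_morphism S T m" and "quantum_cluster_morphism T U m'"
    and "quantum_cluster_morphism U V m''"
  shows "mor_comp S m'' (mor_comp S m' m) = mor_comp S (mor_comp T m'' m') m"
proof -
  obtain F \<chi> \<alpha> where m: "m = (F, \<chi>, \<alpha>)" by (cases m)
  obtain G \<chi>' \<alpha>' where m': "m' = (G, \<chi>', \<alpha>')" by (cases m')
  obtain H \<chi>'' \<alpha>'' where m'': "m'' = (H, \<chi>'', \<alpha>'')" by (cases m'')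
  note mD = quantum_cluster_morphismD [OF assms(1) [unfolded m]]
  note m'D = quantum_cluster_morphismD [OF assms(2) [unfolded m']]
  \<comment> \<open>\<open>restrict_ext\<close> reduces the transformation parts to single objects
    \<open>c\<close>, where the components at \<open>c\<close>, at \<open>FObj F c\<close> and at
    its image under \<open>G\<close> are reassociated as homomorphisms.\<close>
  show ?thesis
    by (auto simp: m m' m'' mor_comp_def functor_comp_assoc [OF mD(1)] FObj_functor_comp mD(6)
        ab_comp_assoc_hom [OF mD(7) adom_ab_hom [OF m'D(7) [OF mD(6)]]]
        ab_comp_assoc_hom [OF mD(8) adom_ab_hom [OF m'D(8) [OF mD(6)]]] intro!: restrict_ext)
qed

theorem theorem3p3:
  shows "category (quantum_cluster_category ::
    (('v, ('v, 'e) sp_arrow, 'x, 'a) quantum_cluster_data,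
     ('v, ('v, 'e) sp_arrow, 'x, 'a) quantum_cluster_data \<times>
     ('v, ('v, 'e) sp_arrow, 'x, 'a) quantum_cluster_data \<times>
     ('v, ('v, 'e) sp_arrow, 'x, 'a) quantum_cluster_mor) category_data)"
  \<comment> \<open>Arrows store their source and target, so the typing axioms amount to identities
    and composites being morphisms, and the equations to the unit and associativity laws for the
    third entry.\<close>
  by unfold_locales
    (auto simp: quantum_cluster_category_def Hom_def Let_def mor_comp_id_left mor_comp_id_right
      mor_comp_assoc intro: quantum_cluster_morphism_mor_id quantum_cluster_morphism_mor_comp)

end
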